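(* Let $N\ge 1$ and let $f$ be a permutation of $\{0,\dots,N-1\}$. Then $f$ can be coded by $4$ lookup tables, each of size at most $N$, such that for every natural number $m$ and every $x\in\{0,\dots,N-1\}$, the value $f^m(x)$ (the $m$-th iterate of $f$ at $x$) can be computed using $5$ invocations (accesses) of these lookup tables and $5$ elementary arithmetic operations (additions, subtractions, or modular reductions); in particular, the number of operations does not depend on $m$.
   Context: A lookup table of size $N$ is an array storing $N$ integer values, each of which can be read by a single access given its index. *)

theory Defs
  imports Main "HOL-Combinatorics.Permutations"
begin

text \<open>
  The cost model is a straight-line register program. The registers form a list that initially
  holds the inputs; every instruction appends one new register with its result, so that each
  intermediate value can be reused at no cost. All operands are register numbers: there are no
  literal constants and no branching, so a program contains no data of its own and everything
  specific to the coded function is held in the tables.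
\<close>

type_synonym lookup_table = "int list"

datatype instr =
    Lookup nat nat  \<comment> \<open>table number, register holding the index\<close>
  | Add nat nat
  | Sub nat nat
  | Mod nat nat

fun is_lookup :: "instr \<Rightarrow> bool" where
  "is_lookup (Lookup _ _) = True"
| "is_lookup _ = False"

definition num_lookups :: "instr list \<Rightarrow> nat" where
  "num_lookups p = length (filter is_lookup p)"

definition num_arith :: "instr list \<Rightarrow> nat" where
  "num_arith p = length (filter (\<lambda>i. \<not> is_lookup i) p)"

definition reg :: "int list \<Rightarrow> nat \<Rightarrow> int option" where
  "reg rs i = (if i < length rs then Some (rs ! i) else None)"

definition read_table :: "lookup_table \<Rightarrow> int \<Rightarrow> int option" where
  "read_table t i = (if 0 \<le> i \<and> i < int (length t) then Some (t ! nat i) else None)"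

text \<open>
  An access to a missing table or register, an access outside the bounds of a table, and a
  reduction by a nonpositive modulus are all failures (None). For a positive modulus the
  reduction is the residue in the interval from 0 up to the modulus, also for negative arguments.
\<close>

fun eval_instr :: "lookup_table list \<Rightarrow> int list \<Rightarrow> instr \<Rightarrow> int option" where
  "eval_instr ts rs (Lookup k i) =
     (if k < length ts then Option.bind (reg rs i) (read_table (ts ! k)) else None)"
| "eval_instr ts rs (Add i j) =
     Option.bind (reg rs i) (\<lambda>a. Option.bind (reg rs j) (\<lambda>b. Some (a + b)))"
| "eval_instr ts rs (Sub i j) =
     Option.bind (reg rs i) (\<lambda>a. Option.bind (reg rs j) (\<lambda>b. Some (a - b)))"
| "eval_instr ts rs (Mod i j) =
     Option.bind (reg rs i) (\<lambda>a. Option.bind (reg rs j)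
       (\<lambda>b. if b > 0 then Some (a mod b) else None))"

fun run :: "lookup_table list \<Rightarrow> instr list \<Rightarrow> int list \<Rightarrow> int list option" where
  "run ts [] rs = Some rs"
| "run ts (i # p) rs = Option.bind (eval_instr ts rs i) (\<lambda>v. run ts p (rs @ [v]))"

text \<open>The output of a program is the content of its last register.\<close>

definition computes :: "lookup_table list \<Rightarrow> instr list \<Rightarrow> int list \<Rightarrow> int \<Rightarrow> bool" where
  "computes ts p inputs y \<longleftrightarrow> (\<exists>rs. run ts p inputs = Some (rs @ [y]))"

end

theory Submission
  imports Defs "HOL-Combinatorics.Orbits"
begin

text \<open>
  Write the cycles of \<open>f\<close> one after the other into an array \<open>A\<close>, and record for each \<open>x\<close> the
  first position \<open>S x\<close> of its cycle, the first position \<open>E x\<close> behind its cycle and its own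
  position \<open>P x\<close>. Applying \<open>f\<close> means moving cyclically inside the segment, hence
  \<open>f\<^sup>m x = A (S x + (P x - S x + m) mod (E x - S x))\<close>, where \<open>S x\<close> is read twice.
\<close>

text \<open>Cycles are split off one at a time: removing the orbit of a point leaves a smaller set
  that \<open>f\<close> still maps into itself, which is why \<open>X\<close> is any such set and
  not the whole domain. \<open>D\<close> is the offset of a point in its segment and
  \<open>L\<close> the length of its cycle.\<close>

lemma cycle_layout_exists:
  fixes f :: "'a \<Rightarrow> 'a"
  assumes "finite X" and "permutation f" and "f ` X \<subseteq> X"
  shows "\<exists>(S :: 'a \<Rightarrow> nat) D L A. \<forall>x\<in>X. L x > 0 \<and>
    (\<forall>m. S x + (D x + m) mod L x < card X \<and> A (S x + (D x + m) mod L x) = (f ^^ m) x)"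
  using assms(1,3)
proof (induction X rule: finite_psubset_induct)
  case (psubset X)
  show ?case
  proof (cases "X = {}")
    case False
    then obtain a where a: "a \<in> X" by blast
    \<comment> \<open>The first positive return time of \<open>a\<close>, hence the length of its
      cycle.\<close>
    define n where "n = funpow_dist1 f a a"
    define C where "C = orbit f a"
    define Y where "Y = X - C"
    have self: "y \<in> orbit f y" for y
      using assms(2) by (rule permutation_self_in_orbit)
    have C_image: "C = (\<lambda>k. (f ^^ k) a) ` {0..<n}"
      unfolding C_def n_def by (rule orbit_conv_funpow_dist1[OF self])
    have "inj_on (\<lambda>k. (f ^^ k) a) {0..<n}"
      unfolding n_def by (rule inj_on_funpow_dist1[OF self])
    then have card_C: "card C = n"
      unfolding C_image by (simp add: card_image)
    have period: "(f ^^ n) a = a"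
      unfolding n_def by (rule funpow_dist1_prop[OF self])
    have "n > 0" by (simp add: n_def)
    have "(f ^^ k) a \<in> X" for k
      using a psubset.prems by (induction k) auto
    then have "C \<subseteq> X" by (auto simp: C_image)
    then have card_X: "card X = card Y + n"
      using psubset.hyps(1) card_C card_mono[of X C]
      by (simp add: Y_def card_Diff_subset finite_subset)
    have "Y \<subset> X" using a self by (auto simp: Y_def C_def)
    moreover have "f ` Y \<subseteq> Y"
    proof -
      \<comment> \<open>Since \<open>f\<close> is a permutation, \<open>y\<close> lies in the orbit
        of \<open>f y\<close>, so no point outside the cycle is mapped into it.\<close>
      have "y \<in> C" if "f y \<in> C" for y
        using that assms(2) self[of y] orbit_trans[of y f "f y" a]
        by (simp add: C_def permutation_orbit_step)
      then show ?thesis using psubset.prems by (auto simp: Y_def)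
    qed
    ultimately obtain S D L A where layout: "\<And>x m. x \<in> Y \<Longrightarrow>
        L x > 0 \<and> S x + (D x + m) mod L x < card Y \<and> A (S x + (D x + m) mod L x) = (f ^^ m) x"
      using psubset.IH[of Y] by metis
    \<comment> \<open>The new cycle goes behind the layout of \<open>Y\<close>, starting with
      \<open>a\<close>. Positions of points of \<open>Y\<close> stay below \<open>card Y\<close>, so
      the case split in \<open>A'\<close> keeps their entries.\<close>
    define S' where "S' x = (if x \<in> C then card Y else S x)" for x
    define D' where "D' x = (if x \<in> C then funpow_dist f a x else D x)" for x
    define L' where "L' x = (if x \<in> C then n else L x)" for x
    define A' where "A' i = (if i < card Y then A i else (f ^^ (i - card Y)) a)" for i
    have "L' x > 0 \<and> S' x + (D' x + m) mod L' x < card X \<and>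
        A' (S' x + (D' x + m) mod L' x) = (f ^^ m) x" if "x \<in> X" for x m
    proof (cases "x \<in> C")
      case True
      then have "(f ^^ funpow_dist f a x) a = x"
        by (simp add: C_def funpow_dist_prop)
      \<comment> \<open>Going from \<open>a\<close> to \<open>x\<close> and then \<open>m\<close>
        steps further gives the right side; full turns of length \<open>n\<close> cancel.\<close>
      then have "(f ^^ ((funpow_dist f a x + m) mod n)) a = (f ^^ m) x"
        using funpow_mod_eq[OF period, of "m + funpow_dist f a x"] by (simp add: funpow_add add.commute)
      with True \<open>n > 0\<close> show ?thesis
        by (simp add: S'_def D'_def L'_def A'_def card_X)
    next
      case False
      with that have "x \<in> Y" by (simp add: Y_def)
      from layout[OF this, of m] False show ?thesis
        by (auto simp: S'_def D'_def L'_def A'_def card_X)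
    qed
    then show ?thesis by blast
  qed simp
qed

definition tabulate :: "nat \<Rightarrow> (nat \<Rightarrow> nat) \<Rightarrow> lookup_table" where
  "tabulate N g = map (\<lambda>i. int (g i)) [0..<N]"

lemma length_tabulate [simp]: "length (tabulate N g) = N"
  by (simp add: tabulate_def)

lemma read_tabulate [simp]: "i < N \<Longrightarrow> read_table (tabulate N g) (int i) = Some (int (g i))"
  by (simp add: tabulate_def read_table_def)

text \<open>With \<open>x\<close> and \<open>m\<close> in registers 0 and 1, register 4 receives
  \<open>D x\<close>, register 8 \<open>L x\<close>, register 9 the offset after \<open>m\<close>
  steps and register 10 its position in \<open>A\<close>.\<close>

definition iterate_program :: "instr list" where
  "iterate_program =
    [Lookup 0 0, Lookup 1 0, Sub 3 2, Add 4 1,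
     Lookup 2 0, Lookup 0 0, Sub 6 7, Mod 5 8,
     Add 9 2, Lookup 3 10]"

text \<open>The two subtractions recover \<open>D x\<close> and \<open>L x\<close> from the stored
  positions. The assumptions keep every access in bounds and the modulus positive, so no instruction
  fails.\<close>

lemma iterate_program_computes:
  assumes "x < N" and "L x > 0" and "S x + (D x + m) mod L x < N"
  shows "computes
    [tabulate N S, tabulate N (\<lambda>i. S i + D i), tabulate N (\<lambda>i. S i + L i), tabulate N A]
    iterate_program [int x, int m] (int (A (S x + (D x + m) mod L x)))"
proof -
  \<comment> \<open>The index as the program forms it over the integers, matched with the
    natural-number position.\<close>
  have "read_table (tabulate N A) ((int (D x) + int m) mod int (L x) + int (S x)) =
      Some (int (A (S x + (D x + m) mod L x)))"
    using read_tabulate[OF assms(3), of A] by (simp add: zmod_int add.commute)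
  with assms show ?thesis
    by (simp add: computes_def iterate_program_def reg_def nth_append numeral_eq_Suc)
qed

theorem theorem2p4:
  fixes N :: nat and f :: "nat \<Rightarrow> nat"
  assumes "N \<ge> 1"
    and "f permutes {0..<N}"
  shows "\<exists>(ts :: lookup_table list) (p :: instr list).
           length ts = 4 \<and> (\<forall>t\<in>set ts. length t \<le> N) \<and>
           num_lookups p = 5 \<and> num_arith p = 5 \<and>
           (\<forall>m::nat. \<forall>x\<in>{0..<N}. computes ts p [int x, int m] (int ((f ^^ m) x)))"
proof -
  have "permutation f"
    using assms(2) by (auto simp: permutation_permutes)
  then have "\<exists>(S :: nat \<Rightarrow> nat) D L A. \<forall>x\<in>{0..<N}. L x > 0 \<and>
      (\<forall>m. S x + (D x + m) mod L x < N \<and> A (S x + (D x + m) mod L x) = (f ^^ m) x)"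
    using cycle_layout_exists[of "{0..<N}" f] assms(2) by (simp add: permutes_image)
  then obtain S D L A where layout: "\<forall>x\<in>{0..<N}. L x > 0 \<and>
      (\<forall>m. S x + (D x + m) mod L x < N \<and> A (S x + (D x + m) mod L x) = (f ^^ m) x)"
    by blast
  let ?ts = "[tabulate N S, tabulate N (\<lambda>i. S i + D i), tabulate N (\<lambda>i. S i + L i), tabulate N A]"
  have "computes ?ts iterate_program [int x, int m] (int ((f ^^ m) x))" if "x < N" for x m
    using iterate_program_computes[OF that, of L S D m A] layout that by simp
  moreover have "num_lookups iterate_program = 5" "num_arith iterate_program = 5"
    by (simp_all add: num_lookups_def num_arith_def iterate_program_def)
  ultimately show ?thesis
    by (intro exI[of _ ?ts] exI[of _ iterate_program]) simp
qed

end
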